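(* Let $(\Lambda,\pi)$ be an action operad. Then the map of operads $\pi:\Lambda\to\Sigma$ gives the category $B\Lambda=\coprod_nB\Lambda(n)$ the structure of a club: the functor $B\pi:B\Lambda\to B\Sigma$, with the multiplication and unit induced by the operadic multiplication and identity of $\Lambda$, is a club.
   Context: $\mathbb N\ni 0$; $e_n$ is the identity of $\Lambda(n)$; permutations compose as functions. A (non-symmetric) operad $O$ in sets: sets $O(n)$ ($n\in\mathbb N$), $\mathrm{id}\in O(1)$, functions $\mu:O(n)\times O(k_1)\times\cdots\times O(k_n)\to O(k_1+\cdots+k_n)$, unital and associative in the usual sense; maps preserve $\mathrm{id}$ and $\mu$. The operad $\Sigma$ of symmetric groups has $\mu^\Sigma(\sigma;\tau_1,\dots,\tau_n)=\delta(\sigma)\cdot\beta(\tau_1,\dots,\tau_n)$, with $\beta$ the block sum of the permutations $\tau_i\in\Sigma_{k_i}$ and $\delta(\sigma)=\delta_{n;k_1,\dots,k_n}(\sigma)$ sending $k_1+\cdots+k_{i-1}+a$ ($1\le a\le k_i$) to $(\sum_{\sigma(i')<\sigma(i)}k_{i'})+a$. An action operad $(\Lambda,\pi)$: an operad $\Lambda$ in sets with a group structure on each $\Lambda(n)$ and a map of operads $\pi:\Lambda\to\Sigma$ whose components are group homomorphisms, such that, writing $g(i)=\pi_n(g)(i)$, $\mu(g';f_1',\dots,f_n')\mu(g;f_1,\dots,f_n)=\mu(g'g;f'_{g(1)}f_1,\dots,f'_{g(n)}f_n)$ for $g,g'\in\Lambda(n)$, $f_i\in\Lambda(k_i)$,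 $f_i'\in\Lambda(k_{g^{-1}(i)})$. $B\Lambda$ is the groupoid with objects the natural numbers, $B\Lambda(n,n)=\Lambda(n)$ with composition the group multiplication, and no morphisms $m\to n$ for $m\ne n$; similarly $B\Sigma$, and $B\pi$ is the identity on objects and $\pi_n$ on morphisms. A club is a monoid in the monoidal category $\mathbf{Cat}/B\Sigma$ of collections for the cartesian 2-monad $T=\underline{E\Sigma}$ (the free symmetric strict monoidal category 2-monad), where $T1=B\Sigma$ and $X\circ Y$ is the pullback of $X\to T1\leftarrow TY$ equipped with the composite $X\circ Y\to TY\to T^21\to T1$. Explicitly, a club is a category $K$ with a functor $k:K\to B\Sigma$, a functor $m:K\circ K\to K$ over $B\Sigma$ and an object $u\in K$ with $k(u)=1$, satisfying strict associativity and unit laws. Here $K\circ K$ has objects $(x;y_1,\dots,y_n)$ with $k(x)=n$; a morphism $(x;y_1,\dots,y_n)\to(z;w_1,\dots,w_n)$ consists of $f:x\to z$ and $g_i:y_i\to w_{k(f)(i)}$ ($1\le i\le n$) in $K$; composition is $(f';g'_1,\dots,g'_n)\circ(f;g_1,\dots,g_n)=(f'f;g'_{k(f)(1)}g_1,\dots,g'_{k(f)(n)}g_n)$; and the functor $K\circ K\to B\Sigma$ sends $(x;y_1,\dots,y_n)$ to $\sum_ik(y_i)$ and $(f;g_1,\dots,g_n)$ to $\mu^\Sigma(k(f);k(g_1),\dots,k(g_n))$. For $B\Lambda$: $m(n;k_1,\dots,k_n)=\sum k_i$, $m(f;g_1,\dots,g_n)=\mu(f;g_1,\dots,g_n)$,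 $u=1$. *)

theory Defs
  imports "HOL-Algebra.Sym_Groups"
begin

text \<open>
  Permutations are functions on \<^typ>\<open>nat\<close> permuting \<open>{1..n}\<close>, as in \<^const>\<open>sym_group\<close>,
  so lists indexed by such permutations are read with indices starting at 1.
\<close>

definition nth1 :: "'a list \<Rightarrow> nat \<Rightarrow> 'a" where
  "nth1 xs i = xs ! (i - 1)"


section \<open>Operads in sets\<close>

text \<open>
  The sets \<open>O(n)\<close> are subsets of one type and need not be disjoint (the groups
  \<open>\<Sigma>\<^sub>n\<close> are not), so the multiplication takes the list of arities
  \<open>[k\<^sub>1, \<dots>, k\<^sub>n]\<close> of its inner arguments as a parameter.
\<close>

record 'a operad_data =
  op_set :: "nat \<Rightarrow> 'a set"
  op_id :: "'a"
  op_mult :: "nat list \<Rightarrow> 'a \<Rightarrow> 'a list \<Rightarrow> 'a"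

locale operad =
  fixes P :: "'a operad_data"
  assumes id_closed: "op_id P \<in> op_set P 1"
    and mult_closed:
      "\<lbrakk> f \<in> op_set P (length ks); list_all2 (\<lambda>k g. g \<in> op_set P k) ks gs \<rbrakk>
       \<Longrightarrow> op_mult P ks f gs \<in> op_set P (sum_list ks)"
    and left_unit: "f \<in> op_set P n \<Longrightarrow> op_mult P [n] (op_id P) [f] = f"
    and right_unit:
      "f \<in> op_set P n \<Longrightarrow> op_mult P (replicate n 1) f (replicate n (op_id P)) = f"
    and assoc:
      "\<lbrakk> f \<in> op_set P (length lss);
         list_all2 (\<lambda>ls g. g \<in> op_set P (length ls)) lss gs;
         list_all2 (list_all2 (\<lambda>l h. h \<in> op_set P l)) lss hss \<rbrakk>
       \<Longrightarrow> op_mult P (concat lss) (op_mult P (map length lss) f gs) (concat hss)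
         = op_mult P (map sum_list lss) f
             (map (\<lambda>i. op_mult P (lss ! i) (gs ! i) (hss ! i)) [0..<length lss])"

locale operad_map = source: operad P + target: operad Q
  for P :: "'a operad_data" and Q :: "'b operad_data" +
  fixes \<phi> :: "nat \<Rightarrow> 'a \<Rightarrow> 'b"
  assumes map_closed: "f \<in> op_set P n \<Longrightarrow> \<phi> n f \<in> op_set Q n"
    and map_id: "\<phi> 1 (op_id P) = op_id Q"
    and map_mult:
      "\<lbrakk> f \<in> op_set P (length ks); list_all2 (\<lambda>k g. g \<in> op_set P k) ks gs \<rbrakk>
       \<Longrightarrow> \<phi> (sum_list ks) (op_mult P ks f gs)
         = op_mult Q ks (\<phi> (length ks) f) (map2 \<phi> ks gs)"


section \<open>The operad of symmetric groups\<close>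

definition offset :: "nat list \<Rightarrow> nat \<Rightarrow> nat" where
  "offset ks i = (\<Sum>j\<in>{1..<i}. nth1 ks j)"

text \<open>Every \<open>p \<in> {1..sum_list ks}\<close> is \<open>offset ks i + a\<close> with \<open>1 \<le> a \<le> k\<^sub>i\<close>
  for a unique block \<open>i\<close>.\<close>

definition block :: "nat list \<Rightarrow> nat \<Rightarrow> nat" where
  "block ks p =
     (THE i. i \<in> {1..length ks} \<and> offset ks i < p \<and> p \<le> offset ks i + nth1 ks i)"

definition block_sum :: "nat list \<Rightarrow> (nat \<Rightarrow> nat) list \<Rightarrow> nat \<Rightarrow> nat" where
  "block_sum ks \<tau>s p =
     (if p \<in> {1..sum_list ks}
      then offset ks (block ks p) + nth1 \<tau>s (block ks p) (p - offset ks (block ks p))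
      else p)"

definition block_perm :: "nat list \<Rightarrow> (nat \<Rightarrow> nat) \<Rightarrow> nat \<Rightarrow> nat" where
  "block_perm ks \<sigma> p =
     (if p \<in> {1..sum_list ks}
      then (\<Sum>j\<in>{j \<in> {1..length ks}. \<sigma> j < \<sigma> (block ks p)}. nth1 ks j)
             + (p - offset ks (block ks p))
      else p)"

definition Sigma_operad :: "(nat \<Rightarrow> nat) operad_data" where
  "Sigma_operad =
     \<lparr> op_set = (\<lambda>n. carrier (sym_group n)),
       op_id = id,
       op_mult = (\<lambda>ks \<sigma> \<tau>s. block_perm ks \<sigma> \<circ> block_sum ks \<tau>s) \<rparr>"


section \<open>Action operads\<close>

locale action_operad = operad_map \<Lambda> Sigma_operad \<pi>
  for \<Lambda> :: "'a operad_data" and \<pi> :: "nat \<Rightarrow> 'a \<Rightarrow> nat \<Rightarrow> nat" +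
  fixes G :: "nat \<Rightarrow> 'a monoid"
  assumes group_G: "group (G n)"
    and carrier_G: "carrier (G n) = op_set \<Lambda> n"
    and \<pi>_hom: "\<pi> n \<in> hom (G n) (sym_group n)"
    and interchange:
      "\<lbrakk> n = length ks; g \<in> op_set \<Lambda> n; g' \<in> op_set \<Lambda> n;
         ks' = map (\<lambda>i. nth1 ks ((inv\<^bsub>sym_group n\<^esub> (\<pi> n g)) i)) [1..<Suc n];
         list_all2 (\<lambda>k f. f \<in> op_set \<Lambda> k) ks fs;
         list_all2 (\<lambda>k f. f \<in> op_set \<Lambda> k) ks' fs' \<rbrakk>
       \<Longrightarrow> op_mult \<Lambda> ks' g' fs' \<otimes>\<^bsub>G (sum_list ks)\<^esub> op_mult \<Lambda> ks g fs
         = op_mult \<Lambda> ks (g' \<otimes>\<^bsub>G n\<^esub> g)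
             (map (\<lambda>i. nth1 fs' (\<pi> n g i) \<otimes>\<^bsub>G (nth1 ks i)\<^esub> nth1 fs i) [1..<Suc n])"


section \<open>Categories and functors\<close>

text \<open>
  Hom-sets need not be disjoint, so composition and the action of a functor on morphisms
  take the objects involved as parameters: \<open>Cmp C x y z g f\<close> is the composite of
  \<open>f : x \<rightarrow> y\<close> and \<open>g : y \<rightarrow> z\<close>.
\<close>

record ('o, 'm) cat =
  Ob :: "'o set"
  Hom :: "'o \<Rightarrow> 'o \<Rightarrow> 'm set"
  Idn :: "'o \<Rightarrow> 'm"
  Cmp :: "'o \<Rightarrow> 'o \<Rightarrow> 'o \<Rightarrow> 'm \<Rightarrow> 'm \<Rightarrow> 'm"

locale category =
  fixes C :: "('o, 'm) cat"
  assumes Idn_in_Hom: "x \<in> Ob C \<Longrightarrow> Idn C x \<in> Hom C x x"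
    and Cmp_in_Hom:
      "\<lbrakk> x \<in> Ob C; y \<in> Ob C; z \<in> Ob C; f \<in> Hom C x y; g \<in> Hom C y z \<rbrakk>
       \<Longrightarrow> Cmp C x y z g f \<in> Hom C x z"
    and Cmp_Idn_left:
      "\<lbrakk> x \<in> Ob C; y \<in> Ob C; f \<in> Hom C x y \<rbrakk> \<Longrightarrow> Cmp C x y y (Idn C y) f = f"
    and Cmp_Idn_right:
      "\<lbrakk> x \<in> Ob C; y \<in> Ob C; f \<in> Hom C x y \<rbrakk> \<Longrightarrow> Cmp C x x y f (Idn C x) = f"
    and Cmp_assoc:
      "\<lbrakk> w \<in> Ob C; x \<in> Ob C; y \<in> Ob C; z \<in> Ob C;
         f \<in> Hom C w x; g \<in> Hom C x y; h \<in> Hom C y z \<rbrakk>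
       \<Longrightarrow> Cmp C w y z h (Cmp C w x y g f) = Cmp C w x z (Cmp C x y z h g) f"

record ('o, 'm, 'p, 'n) func =
  fob :: "'o \<Rightarrow> 'p"
  fmor :: "'o \<Rightarrow> 'o \<Rightarrow> 'm \<Rightarrow> 'n"

locale cat_functor = source: category C + target: category D
  for C :: "('o, 'm) cat" and D :: "('p, 'n) cat" +
  fixes F :: "('o, 'm, 'p, 'n) func"
  assumes fob_closed: "x \<in> Ob C \<Longrightarrow> fob F x \<in> Ob D"
    and fmor_closed:
      "\<lbrakk> x \<in> Ob C; y \<in> Ob C; f \<in> Hom C x y \<rbrakk>
       \<Longrightarrow> fmor F x y f \<in> Hom D (fob F x) (fob F y)"
    and fmor_Idn: "x \<in> Ob C \<Longrightarrow> fmor F x x (Idn C x) = Idn D (fob F x)"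
    and fmor_Cmp:
      "\<lbrakk> x \<in> Ob C; y \<in> Ob C; z \<in> Ob C; f \<in> Hom C x y; g \<in> Hom C y z \<rbrakk>
       \<Longrightarrow> fmor F x z (Cmp C x y z g f)
         = Cmp D (fob F x) (fob F y) (fob F z) (fmor F y z g) (fmor F x y f)"

definition func_comp ::
  "('p, 'n, 'q, 'l) func \<Rightarrow> ('o, 'm, 'p, 'n) func \<Rightarrow> ('o, 'm, 'q, 'l) func"
  (infixl "\<circ>\<^sub>F" 55) where
  "F' \<circ>\<^sub>F F =
     \<lparr> fob = (\<lambda>x. fob F' (fob F x)),
       fmor = (\<lambda>x y f. fmor F' (fob F x) (fob F y) (fmor F x y f)) \<rparr>"

definition func_id :: "('o, 'm, 'o, 'm) func" where
  "func_id = \<lparr> fob = (\<lambda>x. x), fmor = (\<lambda>x y f. f) \<rparr>"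

definition func_eq ::
  "('o, 'm) cat \<Rightarrow> ('o, 'm, 'p, 'n) func \<Rightarrow> ('o, 'm, 'p, 'n) func \<Rightarrow> bool" where
  "func_eq C F F' \<longleftrightarrow>
     (\<forall>x\<in>Ob C. fob F x = fob F' x) \<and>
     (\<forall>x\<in>Ob C. \<forall>y\<in>Ob C. \<forall>f\<in>Hom C x y. fmor F x y f = fmor F' x y f)"


section \<open>Coproducts of one-object groupoids\<close>

definition B_cat :: "(nat \<Rightarrow> 'a monoid) \<Rightarrow> (nat, 'a) cat" where
  "B_cat G =
     \<lparr> Ob = UNIV,
       Hom = (\<lambda>m n. if m = n then carrier (G n) else {}),
       Idn = (\<lambda>n. \<one>\<^bsub>G n\<^esub>),
       Cmp = (\<lambda>_ _ n g f. g \<otimes>\<^bsub>G n\<^esub> f) \<rparr>"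

abbreviation BSigma :: "(nat, nat \<Rightarrow> nat) cat" where
  "BSigma \<equiv> B_cat sym_group"

definition B_func :: "(nat \<Rightarrow> 'a \<Rightarrow> 'b) \<Rightarrow> (nat, 'a, nat, 'b) func" where
  "B_func \<phi> = \<lparr> fob = (\<lambda>n. n), fmor = (\<lambda>_ n g. \<phi> n g) \<rparr>"


section \<open>The composition product of collections\<close>

text \<open>
  A collection is a category with a functor to \<^const>\<open>BSigma\<close>. For collections
  \<open>(X, p)\<close> and \<open>(Y, q)\<close>, \<open>circ_cat X p Y\<close> is the category \<open>X \<circ> Y\<close> and
  \<open>circ_func p q\<close> its functor to \<^const>\<open>BSigma\<close>.
\<close>

type_synonym ('o, 'm) over_Sigma = "('o, 'm, nat, nat \<Rightarrow> nat) func"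

definition circ_cat ::
  "('o, 'm) cat \<Rightarrow> ('o, 'm) over_Sigma \<Rightarrow> ('p, 'n) cat
    \<Rightarrow> ('o \<times> 'p list, 'm \<times> 'n list) cat" where
  "circ_cat X p Y =
     \<lparr> Ob = {(x, ys). x \<in> Ob X \<and> set ys \<subseteq> Ob Y \<and> length ys = fob p x},
       Hom = (\<lambda>(x, ys) (z, ws).
         {(f, gs). f \<in> Hom X x z \<and> length gs = length ys \<and>
            (\<forall>i\<in>{1..length ys}.
               nth1 gs i \<in> Hom Y (nth1 ys i) (nth1 ws (fmor p x z f i)))}),
       Idn = (\<lambda>(x, ys). (Idn X x, map (Idn Y) ys)),
       Cmp = (\<lambda>(x, ys) (x', ys') (x'', ys'') (f', gs') (f, gs).
         (Cmp X x x' x'' f' f,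
          map (\<lambda>i. let j = fmor p x x' f i in
                 Cmp Y (nth1 ys i) (nth1 ys' j) (nth1 ys'' (fmor p x' x'' f' j))
                   (nth1 gs' j) (nth1 gs i))
            [1..<Suc (length ys)])) \<rparr>"

text \<open>For \<open>g\<^sub>i : y\<^sub>i \<rightarrow> w\<^bsub>p(f)(i)\<^esub>\<close>, the list of the \<open>F(g\<^sub>i)\<close>.\<close>

definition fmor_list ::
  "('p, 'n, 'q, 'l) func \<Rightarrow> (nat \<Rightarrow> nat) \<Rightarrow> 'p list \<Rightarrow> 'p list \<Rightarrow> 'n list \<Rightarrow> 'l list" where
  "fmor_list F \<sigma> ys ws gs =
     map (\<lambda>i. fmor F (nth1 ys i) (nth1 ws (\<sigma> i)) (nth1 gs i)) [1..<Suc (length ys)]"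

definition circ_func ::
  "('o, 'm) over_Sigma \<Rightarrow> ('p, 'n) over_Sigma
    \<Rightarrow> ('o \<times> 'p list, 'm \<times> 'n list) over_Sigma" where
  "circ_func p q =
     \<lparr> fob = (\<lambda>(x, ys). sum_list (map (fob q) ys)),
       fmor = (\<lambda>(x, ys) (z, ws) (f, gs).
         op_mult Sigma_operad (map (fob q) ys) (fmor p x z f)
           (fmor_list q (fmor p x z f) ys ws gs)) \<rparr>"

text \<open>The functor \<open>F \<circ> F' : X \<circ> Y \<rightarrow> X' \<circ> Y'\<close> induced by functors \<open>F : X \<rightarrow> X'\<close> and
  \<open>F' : Y \<rightarrow> Y'\<close> over \<^const>\<open>BSigma\<close>, where \<open>p\<close> is the functor from \<open>X\<close> to
  \<^const>\<open>BSigma\<close>.\<close>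

definition circ_map ::
  "('o, 'm) over_Sigma \<Rightarrow> ('o, 'm, 'o1, 'm1) func \<Rightarrow> ('p, 'n, 'p1, 'n1) func
    \<Rightarrow> ('o \<times> 'p list, 'm \<times> 'n list, 'o1 \<times> 'p1 list, 'm1 \<times> 'n1 list) func" where
  "circ_map p F F' =
     \<lparr> fob = (\<lambda>(x, ys). (fob F x, map (fob F') ys)),
       fmor = (\<lambda>(x, ys) (z, ws) (f, gs).
         (fmor F x z f, fmor_list F' (fmor p x z f) ys ws gs)) \<rparr>"

text \<open>The associativity isomorphism \<open>X \<circ> (Y \<circ> Z) \<rightarrow> (X \<circ> Y) \<circ> Z\<close>.\<close>

definition circ_assoc ::
  "('o \<times> ('p \<times> 'q list) list, 'm \<times> ('n \<times> 'l list) list,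
    ('o \<times> 'p list) \<times> 'q list, ('m \<times> 'n list) \<times> 'l list) func" where
  "circ_assoc =
     \<lparr> fob = (\<lambda>(x, yzs). ((x, map fst yzs), concat (map snd yzs))),
       fmor = (\<lambda>_ _ (f, ghs). ((f, map fst ghs), concat (map snd ghs))) \<rparr>"

text \<open>
  The unit collection is the terminal category over the object 1, so a map from it to
  \<open>(K, k)\<close> is an object \<open>u\<close> with \<open>k(u) = 1\<close>. The following are the composites of
  the unit isomorphisms from \<open>K\<close> with \<open>u \<circ> K\<close> and \<open>K \<circ> u\<close>:
  \<open>y \<mapsto> (u; y)\<close> and \<open>x \<mapsto> (x; u, \<dots>, u)\<close>.
\<close>

definition circ_unit_left ::
  "('o, 'm) cat \<Rightarrow> 'o \<Rightarrow> ('o, 'm, 'o \<times> 'o list, 'm \<times> 'm list) func" where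
  "circ_unit_left K u =
     \<lparr> fob = (\<lambda>y. (u, [y])), fmor = (\<lambda>_ _ g. (Idn K u, [g])) \<rparr>"

definition circ_unit_right ::
  "('o, 'm) cat \<Rightarrow> ('o, 'm) over_Sigma \<Rightarrow> 'o
    \<Rightarrow> ('o, 'm, 'o \<times> 'o list, 'm \<times> 'm list) func" where
  "circ_unit_right K k u =
     \<lparr> fob = (\<lambda>x. (x, replicate (fob k x) u)),
       fmor = (\<lambda>x _ f. (f, replicate (fob k x) (Idn K u))) \<rparr>"


section \<open>Clubs\<close>

locale club =
  over: cat_functor K BSigma k + mult: cat_functor "circ_cat K k K" K m
  for K :: "('o, 'm) cat" and k :: "('o, 'm) over_Sigma"
    and m :: "('o \<times> 'o list, 'm \<times> 'm list, 'o, 'm) func" +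
  fixes u :: 'o
  assumes mult_over: "func_eq (circ_cat K k K) (k \<circ>\<^sub>F m) (circ_func k k)"
    and unit_in_Ob: "u \<in> Ob K"
    and unit_over: "fob k u = 1"
    and mult_assoc:
      "func_eq (circ_cat K k (circ_cat K k K))
         (m \<circ>\<^sub>F circ_map (circ_func k k) m func_id \<circ>\<^sub>F circ_assoc)
         (m \<circ>\<^sub>F circ_map k func_id m)"
    and mult_unit_left: "func_eq K (m \<circ>\<^sub>F circ_unit_left K u) func_id"
    and mult_unit_right: "func_eq K (m \<circ>\<^sub>F circ_unit_right K k u) func_id"

definition B_mult ::
  "'a operad_data \<Rightarrow> (nat \<times> nat list, 'a \<times> 'a list, nat, 'a) func" where
  "B_mult P =
     \<lparr> fob = (\<lambda>(n, ks). sum_list ks),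
       fmor = (\<lambda>(n, ks) _ (f, gs). op_mult P ks f gs) \<rparr>"

end

theory Submission
  imports Defs
begin

text \<open>
  Functoriality of the multiplication on composites is the interchange axiom of an action operad:
  a morphism of \<open>K \<circ> K\<close> over \<open>f\<close> permutes the arities by \<open>\<pi>(f)\<close>, which is the arity condition of
  that axiom. The remaining club laws are the operad axioms of \<open>\<Lambda>\<close> and the multiplicativity of
  \<open>\<pi>\<close>, once the operadic identity is known to be the neutral element of \<open>\<Lambda>(1)\<close>.
\<close>

section \<open>Lists read with indices from 1\<close>

lemma nth1_map: "i \<in> {1..length xs} \<Longrightarrow> nth1 (map f xs) i = f (nth1 xs i)"
  by (auto simp: nth1_def)

lemma nth1_map_upt: "i \<in> {1..n} \<Longrightarrow> nth1 (map f [Suc 0..<Suc n]) i = f i"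
  by (auto simp: nth1_def nth_upt simp del: upt_Suc)

lemma nth1_in_set: "i \<in> {1..length xs} \<Longrightarrow> nth1 xs i \<in> set xs"
  by (auto simp: nth1_def)

lemma nth1_Suc: "nth1 xs (Suc j) = xs ! j"
  by (simp add: nth1_def)

text \<open>Turns positions counted from 1 into positions counted from 0, which reduces facts about
  \<open>nth1\<close> to the standard ones about list indexing.\<close>

lemma ball_nth1: "(\<forall>i\<in>{1..n}. P i) \<longleftrightarrow> (\<forall>j<n. P (Suc j))"
  by (metis Suc_le_eq atLeastAtMost_iff One_nat_def Suc_le_D le_add1 plus_1_eq_Suc)

lemma nth1_equalityI:
  assumes "length xs = length ys" "\<And>i. i \<in> {1..length ys} \<Longrightarrow> nth1 xs i = nth1 ys i"
  shows "xs = ys"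
  using assms ball_nth1[of "length ys" "\<lambda>i. nth1 xs i = nth1 ys i"]
  by (auto intro: nth_equalityI simp: nth1_Suc)

text \<open>The bound \<open>n\<close> is separate from \<open>xs\<close> because
  \<open>fmor_list\<close> counts positions in the list of objects while reading the list of
  morphisms; for the identity functor it returns the latter list once the lengths agree.\<close>

lemma map_nth1_upt:
  assumes "length xs = n"
  shows "map (nth1 xs) [1..<Suc n] = xs"
  by (rule nth1_equalityI) (use assms nth1_map_upt[of _ n] in \<open>auto simp del: upt_Suc\<close>)

lemma list_all2_nth1:
  "list_all2 R xs ys \<longleftrightarrow> length xs = length ys \<and> (\<forall>i\<in>{1..length xs}. R (nth1 xs i) (nth1 ys i))"
  by (simp only: ball_nth1 list_all2_conv_all_nth nth1_Suc)

lemma sum_list_nth1: "sum_list xs = (\<Sum>i\<in>{1..length xs}. nth1 xs i)"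
proof -
  have "sum_list xs = (\<Sum>i<length xs. nth1 xs (Suc i))"
    by (simp add: sum_list_sum_nth nth1_Suc atLeast0LessThan)
  also have "\<dots> = (\<Sum>i\<in>{1..length xs}. nth1 xs i)"
    by (simp add: sum.atLeast1_atMost_eq)
  finally show ?thesis .
qed

text \<open>A morphism of the composition product matches source and target arities only up to a
  permutation. Since \<open>B_cat\<close> has no morphisms between distinct numbers, the
  multiplication requires their totals to agree.\<close>

lemma sum_list_permute:
  fixes xs ys :: "'a::comm_monoid_add list"
  assumes "length ys = length xs" "\<sigma> permutes {1..length xs}"
    and "\<And>i. i \<in> {1..length xs} \<Longrightarrow> nth1 xs i = nth1 ys (\<sigma> i)"
  shows "sum_list xs = sum_list ys"
proof -
  have "sum_list xs = (\<Sum>i\<in>{1..length xs}. nth1 ys (\<sigma> i))"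
    using assms(3) by (simp add: sum_list_nth1)
  also have "\<dots> = sum_list ys"
    using sum.permute[OF assms(2), of "nth1 ys"] assms(1) by (simp add: sum_list_nth1 o_def)
  finally show ?thesis .
qed

lemma sum_list_concat: "sum_list (concat xss) = sum_list (map sum_list xss)"
  by (induction xss) simp_all

section \<open>Symmetric groups and the groupoids \<open>B_cat G\<close>\<close>

lemma carrier_sym_group: "carrier (sym_group n) = {\<sigma>. \<sigma> permutes {1..n}}"
  and mult_sym_group: "\<sigma> \<otimes>\<^bsub>sym_group n\<^esub> \<tau> = \<sigma> \<circ> \<tau>"
  and one_sym_group: "\<one>\<^bsub>sym_group n\<^esub> = id"
  by (auto simp: sym_group_def)

lemma category_B_cat:
  assumes "\<And>n. group (G n)"
  shows "category (B_cat G)"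
proof -
  interpret group "G n" for n by (rule assms)
  show ?thesis
    by unfold_locales (auto simp: B_cat_def m_assoc split: if_splits)
qed

lemma Ob_B_cat: "n \<in> Ob (B_cat G)"
  and Hom_B_cat: "f \<in> Hom (B_cat G) m n \<longleftrightarrow> m = n \<and> f \<in> carrier (G n)"
  and Idn_B_cat: "Idn (B_cat G) n = \<one>\<^bsub>G n\<^esub>"
  and Cmp_B_cat: "Cmp (B_cat G) l m n g f = g \<otimes>\<^bsub>G n\<^esub> f"
  by (auto simp: B_cat_def)

lemmas B_cat_simps = Ob_B_cat Hom_B_cat Idn_B_cat Cmp_B_cat

lemma fob_B_func: "fob (B_func \<phi>) n = n"
  and fmor_B_func: "fmor (B_func \<phi>) l n g = \<phi> n g"
  by (simp_all add: B_func_def)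

lemmas B_func_simps = fob_B_func fmor_B_func

lemma cat_functor_B_func:
  assumes "\<And>n. group (G n)" "\<And>n. group (H n)" "\<And>n. \<phi> n \<in> hom (G n) (H n)"
  shows "cat_functor (B_cat G) (B_cat H) (B_func \<phi>)"
proof -
  interpret C: category "B_cat G" by (rule category_B_cat) fact
  interpret D: category "B_cat H" by (rule category_B_cat) fact
  interpret group_hom "G n" "H n" "\<phi> n" for n
    using assms by (simp add: group_hom_def group_hom_axioms_def)
  show ?thesis
    by unfold_locales (auto simp: B_cat_simps B_func_def)
qed

section \<open>The composition product as a category\<close>

lemma Ob_circ_cat:
  "(x, ys) \<in> Ob (circ_cat X p Y) \<longleftrightarrow> x \<in> Ob X \<and> set ys \<subseteq> Ob Y \<and> length ys = fob p x"
  and Hom_circ_cat: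
  "(f, gs) \<in> Hom (circ_cat X p Y) (x, ys) (z, ws) \<longleftrightarrow>
     f \<in> Hom X x z \<and> length gs = length ys \<and>
     (\<forall>i\<in>{1..length ys}. nth1 gs i \<in> Hom Y (nth1 ys i) (nth1 ws (fmor p x z f i)))"
  and Idn_circ_cat: "Idn (circ_cat X p Y) (x, ys) = (Idn X x, map (Idn Y) ys)"
  and Cmp_circ_cat:
  "Cmp (circ_cat X p Y) (x, ys) (x', ys') (x'', ys'') (f', gs') (f, gs) =
     (Cmp X x x' x'' f' f,
      map (\<lambda>i. Cmp Y (nth1 ys i) (nth1 ys' (fmor p x x' f i))
                 (nth1 ys'' (fmor p x' x'' f' (fmor p x x' f i)))
                 (nth1 gs' (fmor p x x' f i)) (nth1 gs i))
        [1..<Suc (length ys)])"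
  by (simp_all add: circ_cat_def Let_def del: upt_Suc)

lemmas circ_cat_simps = Ob_circ_cat Hom_circ_cat Idn_circ_cat Cmp_circ_cat

text \<open>Each law is checked in \<open>X\<close> for the first component and in \<open>Y\<close>
  position by position. Functoriality of \<open>p\<close> makes the permutations compose along with
  the morphisms of \<open>X\<close>, so the list components of a composite meet at the right
  positions.\<close>

lemma category_circ_cat:
  assumes "cat_functor X BSigma p" "category Y"
  shows "category (circ_cat X p Y)"
proof -
  interpret p: cat_functor X BSigma p by fact
  interpret Y: category Y by fact
  let ?C = "circ_cat X p Y"
  \<comment> \<open>As \<open>BSigma\<close> has no morphisms between distinct numbers, a morphism
    of \<open>X\<close> preserves the arity and permutes the positions.\<close>
  have fob_eq: "fob p z = fob p x"
    and perm: "fmor p x z f permutes {1..fob p x}"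
    if "x \<in> Ob X" "z \<in> Ob X" "f \<in> Hom X x z" for x z f
    using p.fmor_closed[OF that] by (auto simp: B_cat_simps carrier_sym_group)
  have fmor_in: "fmor p x z f i \<in> {1..fob p x}"
    if "x \<in> Ob X" "z \<in> Ob X" "f \<in> Hom X x z" "i \<in> {1..fob p x}" for x z f i
    using permutes_in_image[OF perm[OF that(1-3)]] that(4) by simp
  have fmor_Idn: "fmor p x x (Idn X x) i = i" if "x \<in> Ob X" for x i
    using p.fmor_Idn[OF that] by (simp add: B_cat_simps one_sym_group)
  have fmor_Cmp: "fmor p x z (Cmp X x y z g f) i = fmor p y z g (fmor p x y f i)"
    if "x \<in> Ob X" "y \<in> Ob X" "z \<in> Ob X" "f \<in> Hom X x y" "g \<in> Hom X y z" for x y z f g i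
    using p.fmor_Cmp[OF that] by (simp add: B_cat_simps mult_sym_group)
  have in_Ob: "nth1 ys i \<in> Ob Y"
    if "(x, ys) \<in> Ob ?C" "i \<in> {1..fob p x}" for x ys i
    using that nth1_in_set[of i ys] by (auto simp: Ob_circ_cat)
  show ?thesis
  proof
    fix a assume a: "a \<in> Ob ?C"
    obtain x ys where [simp]: "a = (x, ys)" by (cases a)
    show "Idn ?C a \<in> Hom ?C a a"
      using a in_Ob[of x ys]
      by (auto simp: circ_cat_simps nth1_map fmor_Idn p.source.Idn_in_Hom intro: Y.Idn_in_Hom)
  next
    fix a b c F F'
    assume *: "a \<in> Ob ?C" "b \<in> Ob ?C" "c \<in> Ob ?C" "F \<in> Hom ?C a b" "F' \<in> Hom ?C b c"
    obtain x ys y ws z vs f gs f' gs' where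
      [simp]: "a = (x, ys)" "b = (y, ws)" "c = (z, vs)" "F = (f, gs)" "F' = (f', gs')"
      by (cases a, cases b, cases c, cases F, cases F')
    have X: "x \<in> Ob X" "y \<in> Ob X" "z \<in> Ob X" "f \<in> Hom X x y" "f' \<in> Hom X y z"
      using * by (auto simp: circ_cat_simps)
    have L: "length ys = fob p x" "length ws = fob p x" "length vs = fob p x"
      "length gs = fob p x" "length gs' = fob p x" "fob p y = fob p x"
      using * X fob_eq[of x y f] fob_eq[of y z f'] by (auto simp: circ_cat_simps)
    show "Cmp ?C a b c F' F \<in> Hom ?C a c"
      using * X fmor_in[of x y f] fmor_in[of y z f'] L in_Ob[of x ys] in_Ob[of y ws] in_Ob[of z vs]
      by (auto simp: circ_cat_simps nth1_map_upt fmor_Cmp fob_eq simp del: upt_Suc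
          intro!: p.source.Cmp_in_Hom[of x y z] Y.Cmp_in_Hom)
  next
    fix a b F
    assume *: "a \<in> Ob ?C" "b \<in> Ob ?C" "F \<in> Hom ?C a b"
    obtain x ys y ws f gs where [simp]: "a = (x, ys)" "b = (y, ws)" "F = (f, gs)"
      by (cases a, cases b, cases F)
    have X: "x \<in> Ob X" "y \<in> Ob X" "f \<in> Hom X x y"
      using * by (auto simp: circ_cat_simps)
    have L: "length ys = fob p x" "length ws = fob p x" "length gs = fob p x" "fob p y = fob p x"
      using * X fob_eq[of x y f] by (auto simp: circ_cat_simps)
    have gs: "nth1 gs i \<in> Hom Y (nth1 ys i) (nth1 ws (fmor p x y f i))"
      if "i \<in> {1..fob p x}" for i
      using * that L by (auto simp: circ_cat_simps)
    show "Cmp ?C a b b (Idn ?C b) F = F"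
      using X L fmor_in[of x y f] in_Ob[of x ys] in_Ob[of y ws] *(1,2) gs
      by (auto simp: circ_cat_simps nth1_map_upt nth1_map[of _ ws] fmor_Idn p.source.Cmp_Idn_left
          Y.Cmp_Idn_left simp del: upt_Suc intro!: nth1_equalityI)
    show "Cmp ?C a a b F (Idn ?C a) = F"
      using X L fmor_in[of x y f] in_Ob[of x ys] in_Ob[of y ws] *(1,2) gs
      by (auto simp: circ_cat_simps nth1_map_upt nth1_map[of _ ys] fmor_Idn p.source.Cmp_Idn_right
          Y.Cmp_Idn_right simp del: upt_Suc intro!: nth1_equalityI)
  next
    fix a b c d F F' F''
    assume *: "a \<in> Ob ?C" "b \<in> Ob ?C" "c \<in> Ob ?C" "d \<in> Ob ?C"
      "F \<in> Hom ?C a b" "F' \<in> Hom ?C b c" "F'' \<in> Hom ?C c d"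
    obtain w vs x ws y xs z ys f gs f' gs' f'' gs'' where
      [simp]: "a = (w, vs)" "b = (x, ws)" "c = (y, xs)" "d = (z, ys)"
        "F = (f, gs)" "F' = (f', gs')" "F'' = (f'', gs'')"
      by (cases a, cases b, cases c, cases d, cases F, cases F', cases F'')
    have X: "w \<in> Ob X" "x \<in> Ob X" "y \<in> Ob X" "z \<in> Ob X"
      "f \<in> Hom X w x" "f' \<in> Hom X x y" "f'' \<in> Hom X y z"
      using * by (auto simp: circ_cat_simps)
    have E: "fob p x = fob p w" "fob p y = fob p w" "fob p z = fob p w"
      using X fob_eq by metis+
    have L: "length vs = fob p w" "length ws = fob p w" "length xs = fob p w" "length ys = fob p w"
      "length gs = fob p w" "length gs' = fob p w" "length gs'' = fob p w"
      using * E by (auto simp: circ_cat_simps)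
    \<comment> \<open>The indices \<open>j\<close>, \<open>k\<close>, \<open>l\<close> follow
      position \<open>i\<close> through the three permutations. The equation is then associativity
      in \<open>Y\<close> for the three morphisms met on the way.\<close>
    have "Cmp Y (nth1 vs i) (nth1 xs k) (nth1 ys l) (nth1 gs'' k)
          (Cmp Y (nth1 vs i) (nth1 ws j) (nth1 xs k) (nth1 gs' j) (nth1 gs i))
        = Cmp Y (nth1 vs i) (nth1 ws j) (nth1 ys l)
          (Cmp Y (nth1 ws j) (nth1 xs k) (nth1 ys l) (nth1 gs'' k) (nth1 gs' j)) (nth1 gs i)"
      if i: "i \<in> {1..fob p w}" and j: "j = fmor p w x f i" and k: "k = fmor p x y f' j"
        and l: "l = fmor p y z f'' k" for i j k l
    proof -
      have J: "j \<in> {1..fob p w}" using fmor_in[OF X(1,2,5) i] j by simp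
      have K: "k \<in> {1..fob p w}" using fmor_in[OF X(2,3,6)] J k E by simp
      have l': "l \<in> {1..fob p w}" using fmor_in[OF X(3,4,7)] K l E by simp
      have "nth1 vs i \<in> Ob Y" "nth1 ws j \<in> Ob Y" "nth1 xs k \<in> Ob Y" "nth1 ys l \<in> Ob Y"
        using *(1-4) i J K l' E in_Ob by simp_all
      moreover have "nth1 gs i \<in> Hom Y (nth1 vs i) (nth1 ws j)"
        using *(5) i L unfolding j by (simp add: Hom_circ_cat)
      moreover have "nth1 gs' j \<in> Hom Y (nth1 ws j) (nth1 xs k)"
        using *(6) J L unfolding k by (simp add: Hom_circ_cat)
      moreover have "nth1 gs'' k \<in> Hom Y (nth1 xs k) (nth1 ys l)"
        using *(7) K L unfolding l by (simp add: Hom_circ_cat)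
      ultimately show ?thesis
        by (rule Y.Cmp_assoc)
    qed
    from this[OF _ refl refl refl]
    show "Cmp ?C a c d F'' (Cmp ?C a b c F' F) = Cmp ?C a b d (Cmp ?C b c d F'' F') F"
      using X L E fmor_in[of w x f]
      by (auto simp: circ_cat_simps nth1_map_upt fmor_Cmp p.source.Cmp_assoc
          simp del: upt_Suc intro!: nth1_equalityI)
  qed
qed

section \<open>Consequences of the interchange axiom\<close>

context action_operad
begin

sublocale G: group "G n" for n
  by (rule group_G)

sublocale \<pi>: group_hom "G n" "sym_group n" "\<pi> n" for n
  by (simp add: group_hom_def group_hom_axioms_def group_G sym_group_is_group \<pi>_hom)

lemma \<pi>_permutes: "g \<in> carrier (G n) \<Longrightarrow> \<pi> n g permutes {1..n}"
  using \<pi>.hom_closed by (simp add: carrier_sym_group)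

lemma inv_\<pi>:
  assumes "g \<in> carrier (G n)"
  shows "\<pi> n g ((inv\<^bsub>sym_group n\<^esub> (\<pi> n g)) i) = i"
    and "(inv\<^bsub>sym_group n\<^esub> (\<pi> n g)) permutes {1..n}"
  using \<pi>.H.r_inv[OF \<pi>.hom_closed[OF assms]]
    \<pi>.H.inv_closed[OF \<pi>.hom_closed[OF assms]]
  by (auto simp: mult_sym_group one_sym_group carrier_sym_group fun_eq_iff)

lemma op_mult_closed:
  assumes "f \<in> carrier (G (length ks))" "list_all2 (\<lambda>k g. g \<in> carrier (G k)) ks gs"
  shows "op_mult \<Lambda> ks f gs \<in> carrier (G (sum_list ks))"
  using assms source.mult_closed by (simp add: carrier_G)

text \<open>Interchange with the arities matched along \<open>\<pi> g\<close> instead of its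
  inverse, which is how a morphism of the composition product supplies them.\<close>

lemma op_mult_mult:
  assumes "g \<in> carrier (G (length ks))" "g' \<in> carrier (G (length ks))"
    and "length ks' = length ks"
    and ks: "\<And>i. i \<in> {1..length ks} \<Longrightarrow> nth1 ks i = nth1 ks' (\<pi> (length ks) g i)"
    and "list_all2 (\<lambda>k f. f \<in> carrier (G k)) ks fs"
    and "list_all2 (\<lambda>k f. f \<in> carrier (G k)) ks' fs'"
  shows "op_mult \<Lambda> ks' g' fs' \<otimes>\<^bsub>G (sum_list ks)\<^esub> op_mult \<Lambda> ks g fs
    = op_mult \<Lambda> ks (g' \<otimes>\<^bsub>G (length ks)\<^esub> g)
        (map (\<lambda>i. nth1 fs' (\<pi> (length ks) g i) \<otimes>\<^bsub>G (nth1 ks i)\<^esub> nth1 fs i) [1..<Suc (length ks)])"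
proof (rule interchange)
  let ?s = "inv\<^bsub>sym_group (length ks)\<^esub> (\<pi> (length ks) g)"
  show "ks' = map (\<lambda>i. nth1 ks (?s i)) [1..<Suc (length ks)]"
  proof (rule nth1_equalityI)
    fix i assume "i \<in> {1..length (map (\<lambda>i. nth1 ks (?s i)) [1..<Suc (length ks)])}"
    then have i: "i \<in> {1..length ks}" by (simp del: upt_Suc)
    then have "?s i \<in> {1..length ks}"
      using permutes_in_image[OF inv_\<pi>(2)[OF assms(1)]] by blast
    \<comment> \<open>The hypothesis is used at the preimage \<open>?s i\<close>, which
      \<open>\<pi> g\<close> sends back to \<open>i\<close>.\<close>
    from ks[OF this] show "nth1 ks' i = nth1 (map (\<lambda>i. nth1 ks (?s i)) [1..<Suc (length ks)]) i"
      using inv_\<pi>(1)[OF assms(1)] i by (simp add: nth1_map_upt del: upt_Suc)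
  qed (use assms in \<open>simp del: upt_Suc\<close>)
qed (use assms in \<open>simp_all add: carrier_G\<close>)

text \<open>Interchange makes this element idempotent.\<close>

lemma op_mult_one:
  "op_mult \<Lambda> ks \<one>\<^bsub>G (length ks)\<^esub> (map (\<lambda>k. \<one>\<^bsub>G k\<^esub>) ks) = \<one>\<^bsub>G (sum_list ks)\<^esub>" (is "?e = _")
proof -
  have all: "list_all2 (\<lambda>k f. f \<in> carrier (G k)) ks (map (\<lambda>k. \<one>\<^bsub>G k\<^esub>) ks)"
    by (simp add: list_all2_conv_all_nth)
  have one: "\<pi> (length ks) \<one>\<^bsub>G (length ks)\<^esub> i = i" for i
    by (simp add: one_sym_group)
  have "map (\<lambda>i. nth1 (map (\<lambda>k. \<one>\<^bsub>G k\<^esub>) ks) i \<otimes>\<^bsub>G (nth1 ks i)\<^esub> nth1 (map (\<lambda>k. \<one>\<^bsub>G k\<^esub>) ks) i)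
      [1..<Suc (length ks)] = map (\<lambda>k. \<one>\<^bsub>G k\<^esub>) ks"
    by (rule nth1_equalityI) (simp_all add: nth1_map_upt nth1_map[of _ ks] del: upt_Suc)
  then have "?e \<otimes>\<^bsub>G (sum_list ks)\<^esub> ?e = ?e"
    using op_mult_mult[OF _ _ _ _ all all, of "\<one>\<^bsub>G (length ks)\<^esub>" "\<one>\<^bsub>G (length ks)\<^esub>"]
    by (simp add: one del: \<pi>.hom_one upt_Suc)
  then show ?thesis
    \<comment> \<open>By cancellation, an idempotent of a group is its neutral element.\<close>
    using op_mult_closed[OF _ all] G.r_cancel_one by auto
qed

text \<open>Eckmann--Hilton, for the two unital multiplications on the unary operations.\<close>

lemma op_id_eq_one: "op_id \<Lambda> = \<one>\<^bsub>G 1\<^esub>"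
proof -
  have closed: "op_id \<Lambda> \<in> carrier (G 1)"
    using source.id_closed by (simp add: carrier_G)
  have "\<pi> 1 \<one>\<^bsub>G 1\<^esub> = id"
    by (simp add: one_sym_group)
  \<comment> \<open>The two identities are placed crosswise: the unit laws turn both factors on the
    left into the neutral element and the right side into \<open>op_id \<Lambda>\<close>.\<close>
  then have "op_mult \<Lambda> [1] (op_id \<Lambda>) [\<one>\<^bsub>G 1\<^esub>] \<otimes>\<^bsub>G 1\<^esub> op_mult \<Lambda> [1] \<one>\<^bsub>G 1\<^esub> [op_id \<Lambda>]
      = op_mult \<Lambda> [1] (op_id \<Lambda>) [op_id \<Lambda>]"
    using op_mult_mult[of "\<one>\<^bsub>G 1\<^esub>" "[1]" "op_id \<Lambda>" "[1]" "[op_id \<Lambda>]" "[\<one>\<^bsub>G 1\<^esub>]"] closed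
    by (simp add: nth1_def)
  moreover have "op_mult \<Lambda> [1] (op_id \<Lambda>) [x] = x" if "x \<in> carrier (G 1)" for x
    using source.left_unit that by (simp add: carrier_G)
  moreover have "op_mult \<Lambda> [1] \<one>\<^bsub>G 1\<^esub> [op_id \<Lambda>] = \<one>\<^bsub>G 1\<^esub>"
    using source.right_unit[of "\<one>\<^bsub>G 1\<^esub>" 1] G.one_closed[of 1] by (simp add: carrier_G)
  ultimately show ?thesis
    using closed by simp
qed

section \<open>The club structure on \<open>B_cat G\<close>\<close>

abbreviation "K \<equiv> B_cat G"
abbreviation "k \<equiv> B_func \<pi>"
abbreviation "m \<equiv> B_mult \<Lambda>"

lemma cat_functor_k: "cat_functor K BSigma k"
  by (rule cat_functor_B_func) (rule group_G sym_group_is_group \<pi>_hom)+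

text \<open>Kept general in \<open>Y\<close> because associativity also takes
  \<open>circ_cat K k K\<close> as the inner category.\<close>

lemma Ob_KK: "(n, ks) \<in> Ob (circ_cat K k Y) \<longleftrightarrow> set ks \<subseteq> Ob Y \<and> length ks = n"
  by (simp add: circ_cat_simps Ob_B_cat B_func_def)

text \<open>Morphisms of \<open>K\<close> exist only between equal objects, so the components of
  \<open>gs\<close> force the arities in \<open>ls\<close> to be those in \<open>ks\<close>, moved
  along \<open>\<pi> f\<close>. This yields the arity hypothesis of \<open>op_mult_mult\<close> and,
  by permuting a sum, equal totals.\<close>

lemma Hom_KK:
  assumes "(n, ks) \<in> Ob (circ_cat K k K)" "(n', ls) \<in> Ob (circ_cat K k K)"
    and "(f, gs) \<in> Hom (circ_cat K k K) (n, ks) (n', ls)"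
  shows "n = length ks" "n' = length ks" "length ls = length ks"
    and "f \<in> carrier (G (length ks))"
    and "length gs = length ks"
    and "list_all2 (\<lambda>k g. g \<in> carrier (G k)) ks gs"
    and "\<And>i. i \<in> {1..length ks} \<Longrightarrow> nth1 ls (\<pi> (length ks) f i) = nth1 ks i"
    and "sum_list ks = sum_list ls"
proof -
  have "length ks = n" "length ls = n'"
    using assms(1,2) by (simp_all only: Ob_KK)
  then show *: "n = length ks" "n' = length ks" "length ls = length ks" "f \<in> carrier (G (length ks))"
    "length gs = length ks" "list_all2 (\<lambda>k g. g \<in> carrier (G k)) ks gs"
    "\<And>i. i \<in> {1..length ks} \<Longrightarrow> nth1 ls (\<pi> (length ks) f i) = nth1 ks i"
    using assms(3) by (auto simp: Hom_circ_cat Hom_B_cat B_func_def list_all2_nth1)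
  show "sum_list ks = sum_list ls"
    using * \<pi>_permutes[of f "length ks"] by (intro sum_list_permute) auto
qed

text \<open>Equal totals make the values morphisms of \<open>K\<close>, \<open>op_mult_one\<close>
  preserves identities, and \<open>op_mult_mult\<close> preserves composition.\<close>

lemma cat_functor_m: "cat_functor (circ_cat K k K) K m"
proof -
  interpret C: category "circ_cat K k K"
    by (intro category_circ_cat cat_functor_k category_B_cat group_G)
  interpret D: category K
    by (intro category_B_cat group_G)
  show ?thesis
  proof
    fix a b F
    assume *: "a \<in> Ob (circ_cat K k K)" "b \<in> Ob (circ_cat K k K)" "F \<in> Hom (circ_cat K k K) a b"
    obtain x ks y ls f gs where [simp]: "a = (x, ks)" "b = (y, ls)" "F = (f, gs)"
      by (cases a, cases b, cases F)
    note 1 = Hom_KK[OF *[simplified]]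
    show "fmor m a b F \<in> Hom K (fob m a) (fob m b)"
      using op_mult_closed[OF 1(4,6)] 1(8) by (simp add: B_mult_def Hom_B_cat)
  next
    fix a assume "a \<in> Ob (circ_cat K k K)"
    then show "fmor m a a (Idn (circ_cat K k K) a) = Idn K (fob m a)"
      using op_mult_one
      by (cases a) (auto simp: B_mult_def Ob_KK Idn_circ_cat Idn_B_cat[abs_def])
  next
    fix a b c F F'
    assume *: "a \<in> Ob (circ_cat K k K)" "b \<in> Ob (circ_cat K k K)" "c \<in> Ob (circ_cat K k K)"
      "F \<in> Hom (circ_cat K k K) a b" "F' \<in> Hom (circ_cat K k K) b c"
    obtain x ks y ls z ms f gs f' gs' where
      [simp]: "a = (x, ks)" "b = (y, ls)" "c = (z, ms)" "F = (f, gs)" "F' = (f', gs')"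
      by (cases a, cases b, cases c, cases F, cases F')
    note 1 = Hom_KK[OF *(1,2,4)[simplified]] and 2 = Hom_KK[OF *(2,3,5)[simplified]]
    \<comment> \<open>Composition in \<open>K\<close> multiplies in the group at the final target,
      whereas interchange uses the group at the source arity. Following position \<open>i\<close>
      through both permutations shows that these are the same group.\<close>
    have "nth1 ms (\<pi> (length ks) f' (\<pi> (length ks) f i)) = nth1 ks i"
      if i: "i \<in> {1..length ks}" for i
    proof -
      have "\<pi> (length ks) f i \<in> {1..length ls}"
        using i 1(3) permutes_in_image[OF \<pi>_permutes[OF 1(4)]] by simp
      from 2(7)[OF this] show ?thesis
        using 1(3) 1(7)[OF i] by simp
    qed
    then have "map (\<lambda>i. nth1 gs' (\<pi> (length ks) f i) \<otimes>\<^bsub>G (nth1 ms (\<pi> (length ks) f' (\<pi> (length ks) f i)))\<^esub> nth1 gs i)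
        [1..<Suc (length ks)] =
      map (\<lambda>i. nth1 gs' (\<pi> (length ks) f i) \<otimes>\<^bsub>G (nth1 ks i)\<^esub> nth1 gs i) [1..<Suc (length ks)]"
      by (intro map_cong refl) (auto simp del: upt_Suc)
    moreover have "op_mult \<Lambda> ls f' gs' \<otimes>\<^bsub>G (sum_list ks)\<^esub> op_mult \<Lambda> ks f gs
      = op_mult \<Lambda> ks (f' \<otimes>\<^bsub>G (length ks)\<^esub> f)
        (map (\<lambda>i. nth1 gs' (\<pi> (length ks) f i) \<otimes>\<^bsub>G (nth1 ks i)\<^esub> nth1 gs i) [1..<Suc (length ks)])"
      using 1 2 by (intro op_mult_mult) auto
    ultimately show "fmor m a c (Cmp (circ_cat K k K) a b c F' F)
      = Cmp K (fob m a) (fob m b) (fob m c) (fmor m b c F') (fmor m a b F)"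
      using 1 2 by (simp add: B_mult_def B_func_def Cmp_circ_cat Cmp_B_cat del: upt_Suc map_eq_conv)
  qed (auto simp: Ob_B_cat)
qed

lemma m_over_Sigma: "func_eq (circ_cat K k K) (k \<circ>\<^sub>F m) (circ_func k k)"
  unfolding func_eq_def
proof (intro conjI ballI)
  fix a b F
  assume *: "a \<in> Ob (circ_cat K k K)" "b \<in> Ob (circ_cat K k K)" "F \<in> Hom (circ_cat K k K) a b"
  obtain x ks y ls f gs where [simp]: "a = (x, ks)" "b = (y, ls)" "F = (f, gs)"
    by (cases a, cases b, cases F)
  note 1 = Hom_KK[OF *[simplified]]
  \<comment> \<open>\<open>B_func\<close> applies \<pi> at the target arity, while
    \<open>map_mult\<close> applies it at the source arity; the two coincide along the
    permutation.\<close>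
  have "map (\<lambda>i. \<pi> (nth1 ls (\<pi> (length ks) f i)) (nth1 gs i)) [1..<Suc (length ks)] = map2 \<pi> ks gs"
  proof (rule nth1_equalityI)
    fix i assume "i \<in> {1..length (map2 \<pi> ks gs)}"
    then have i: "i \<in> {1..length ks}" by simp
    then have "nth1 (map2 \<pi> ks gs) i = \<pi> (nth1 ks i) (nth1 gs i)"
      using 1(5) by (auto simp: nth1_def)
    then show "nth1 (map (\<lambda>i. \<pi> (nth1 ls (\<pi> (length ks) f i)) (nth1 gs i)) [1..<Suc (length ks)]) i
        = nth1 (map2 \<pi> ks gs) i"
      using 1(7) i by (simp add: nth1_map_upt del: upt_Suc)
  qed (use 1 in \<open>simp del: upt_Suc\<close>)
  then show "fmor (k \<circ>\<^sub>F m) a b F = fmor (circ_func k k) a b F"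
    using 1 map_mult[of f ks gs]
    by (simp add: func_comp_def circ_func_def B_mult_def B_func_def fmor_list_def carrier_G
        del: upt_Suc)
qed (auto simp: func_comp_def circ_func_def B_mult_def B_func_def)

text \<open>On objects this is summing a concatenation block by block. On morphisms it is operadic
  associativity, with the first entries of \<open>Fs\<close> as the middle operations and the second
  entries as the lists of innermost ones.\<close>

lemma m_assoc:
  "func_eq (circ_cat K k (circ_cat K k K))
     (m \<circ>\<^sub>F circ_map (circ_func k k) m func_id \<circ>\<^sub>F circ_assoc)
     (m \<circ>\<^sub>F circ_map k func_id m)"
  unfolding func_eq_def
proof (intro conjI ballI)
  fix a assume "a \<in> Ob (circ_cat K k (circ_cat K k K))"
  show "fob (m \<circ>\<^sub>F circ_map (circ_func k k) m func_id \<circ>\<^sub>F circ_assoc) a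
    = fob (m \<circ>\<^sub>F circ_map k func_id m) a"
    by (cases a)
      (simp add: func_comp_def circ_map_def circ_assoc_def func_id_def B_mult_def
        sum_list_concat o_def case_prod_unfold)
next
  let ?KK = "circ_cat K k K"
  fix a b F
  assume *: "a \<in> Ob (circ_cat K k ?KK)" "b \<in> Ob (circ_cat K k ?KK)"
    "F \<in> Hom (circ_cat K k ?KK) a b"
  obtain x as y bs f Fs where [simp]: "a = (x, as)" "b = (y, bs)" "F = (f, Fs)"
    by (cases a, cases b, cases F)
  define lss where "lss = map snd as"
  have as: "set as \<subseteq> Ob ?KK" "length as = x" and bs: "set bs \<subseteq> Ob ?KK" "length bs = y"
    using *(1,2) by (simp_all add: Ob_KK)
  moreover have "x = y" and f: "f \<in> carrier (G y)"
    and Fs: "length Fs = length as"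
      "\<forall>i\<in>{1..length as}. nth1 Fs i \<in> Hom ?KK (nth1 as i) (nth1 bs (\<pi> y f i))"
    using *(3) by (simp_all add: Hom_circ_cat[of f Fs] Hom_B_cat B_func_simps)
  ultimately have L: "x = length as" "y = length as" "length bs = length as" "length Fs = length as"
    by simp_all
  note f = f[unfolded L(2)] and Fs = Fs(2)[unfolded L(2)]
  \<comment> \<open>The first entry of an object of the composition product is the length of its
    list, so the middle arities take the form \<open>map length lss\<close> used by operadic
    associativity.\<close>
  have fst_as: "map fst as = map length lss"
    using as by (auto simp: lss_def Ob_KK B_func_simps)
  \<comment> \<open>Each entry of \<open>Fs\<close> is itself a morphism of the composition product,
    so \<open>Hom_KK\<close> applies; the entry \<open>Fs ! j\<close> sits at position
    \<open>Suc j\<close>.\<close>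
  have component: "fst (Fs ! j) \<in> carrier (G (length (lss ! j)))
      \<and> length (snd (Fs ! j)) = length (lss ! j)
      \<and> list_all2 (\<lambda>l h. h \<in> carrier (G l)) (lss ! j) (snd (Fs ! j))" if "j < length as" for j
  proof -
    have i: "Suc j \<in> {1..length as}" using that by simp
    have "nth1 as (Suc j) \<in> Ob ?KK" "nth1 bs (\<pi> (length as) f (Suc j)) \<in> Ob ?KK"
      using i as bs L nth1_in_set permutes_in_image[OF \<pi>_permutes[OF f]] by (metis subsetD)+
    then show ?thesis
      using Hom_KK[of "fst (as ! j)" "snd (as ! j)" _ _ "fst (Fs ! j)" "snd (Fs ! j)"] bspec[OF Fs i] that
      by (simp add: lss_def nth1_Suc) (metis prod.collapse)
  qed
  have "list_all2 (\<lambda>ls g. g \<in> op_set \<Lambda> (length ls)) lss (map fst Fs)"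
    "list_all2 (list_all2 (\<lambda>l h. h \<in> op_set \<Lambda> l)) lss (map snd Fs)"
    by (rule list_all2_all_nthI; use component L in \<open>simp add: lss_def carrier_G\<close>)+
  then have assoc: "op_mult \<Lambda> (concat lss) (op_mult \<Lambda> (map length lss) f (map fst Fs)) (concat (map snd Fs))
      = op_mult \<Lambda> (map sum_list lss) f
          (map (\<lambda>i. op_mult \<Lambda> (lss ! i) (map fst Fs ! i) (map snd Fs ! i)) [0..<length lss])"
    using f by (intro source.assoc) (simp_all add: carrier_G lss_def)
  \<comment> \<open>There are as many innermost operations as innermost arities. Hence
    \<open>fmor_list\<close> with the identity functor, which counts the arities, returns the whole
    list of operations.\<close>
  have "map length (map snd Fs) = map length lss"
    using component L by (auto simp: lss_def intro!: nth_equalityI)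
  then have len: "length (concat (map snd Fs)) = length (concat lss)"
    by (simp only: length_concat)
  \<comment> \<open>The operad law lists the inner composites from index 0, \<open>fmor_list\<close>
    from index 1; the entries are the same.\<close>
  have "map (\<lambda>i. op_mult \<Lambda> (lss ! i) (map fst Fs ! i) (map snd Fs ! i)) [0..<length lss]
      = fmor_list m (\<pi> (length as) f) as bs Fs"
    using L by (auto simp: fmor_list_def lss_def B_mult_def case_prod_beta nth1_def
        simp del: upt_Suc intro!: nth_equalityI)
  moreover have "fmor_list func_id \<sigma> (concat lss) ws (concat (map snd Fs)) = concat (map snd Fs)"
    for \<sigma> :: "nat \<Rightarrow> nat" and ws :: "nat list"
    using map_nth1_upt[OF len] by (simp add: fmor_list_def func_id_def del: upt_Suc)
  ultimately show "fmor (m \<circ>\<^sub>F circ_map (circ_func k k) m func_id \<circ>\<^sub>F circ_assoc) a b F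
    = fmor (m \<circ>\<^sub>F circ_map k func_id m) a b F"
    using assoc L fst_as
    by (simp add: func_comp_def circ_map_def circ_assoc_def B_mult_def[of \<Lambda>] B_func_def[of \<pi>] lss_def
        func_id_def o_def case_prod_unfold del: map_eq_conv)
qed

text \<open>Here and in the next lemma, the identity morphism of the unit object is the neutral
  element of \<open>G 1\<close>; \<open>op_id_eq_one\<close> identifies it with the operadic
  identity, so the unit laws of \<Lambda> apply.\<close>

lemma m_unit_left: "func_eq K (m \<circ>\<^sub>F circ_unit_left K 1) func_id"
  using source.left_unit op_id_eq_one
  by (auto simp: func_eq_def func_comp_def circ_unit_left_def func_id_def B_mult_def B_cat_simps
      carrier_G)

lemma m_unit_right: "func_eq K (m \<circ>\<^sub>F circ_unit_right K k 1) func_id"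
  using source.right_unit op_id_eq_one
  by (auto simp: func_eq_def func_comp_def circ_unit_right_def func_id_def B_mult_def B_func_def
      B_cat_simps carrier_G sum_list_replicate)

lemma club_B: "club K k m 1"
  by (intro club.intro club_axioms.intro cat_functor_k cat_functor_m m_over_Sigma m_assoc
      m_unit_left m_unit_right) (simp_all add: Ob_B_cat B_func_def)

end

theorem theorem15p8:
  fixes \<Lambda> :: "'a operad_data"
    and \<pi> :: "nat \<Rightarrow> 'a \<Rightarrow> nat \<Rightarrow> nat"
    and G :: "nat \<Rightarrow> 'a monoid"
  assumes "action_operad \<Lambda> \<pi> G"
  shows "club (B_cat G) (B_func \<pi>) (B_mult \<Lambda>) 1"
  using assms by (rule action_operad.club_B)

end
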